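(* Let $F$ be a forest with $n$ vertices, $c$ connected components and no isolated vertices. Then $$\max\Big\{\frac n2,\ |\mathit{Deg}_1(F)|-c\Big\}\le\beta(F)\le\frac12\big(n+|\mathit{Deg}_1(F)|\big).$$
   Context: $\beta(F)$ is the independence number (size of a maximum independent set) of $F$. $\mathit{Deg}_1(F)$ is the set of leaves of $F$, i.e., vertices of degree exactly $1$. *)

theory Defs
  imports Complex_Main "Graph_Theory.Digraph_Component"
begin

text \<open>
  A finite simple undirected graph is a digraph in the locale \<open>graph\<close>: every undirected edge
  is the pair of opposite arcs between its two endpoints. Hence the degree of a vertex is its
  \<open>out_degree\<close>, and the connected components are the strongly connected components \<open>sccs\<close>.
\<close>

text \<open>
  The constant \<open>Digraph_Component.forest\<close> is unsuitable here: on symmetric digraphs it counts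
  the closed walk \<open>a, b, a\<close> along a single edge as a cycle. Closed walks of length at least 3
  without repeated vertices are exactly the cycles of a simple undirected graph.
\<close>
definition simple_forest :: "('a, 'b) pre_digraph \<Rightarrow> bool" where
  "simple_forest G \<longleftrightarrow> Digraph.graph G \<and> (\<nexists>p. pre_digraph.cycle G p \<and> 3 \<le> length p)"

definition leaves :: "('a, 'b) pre_digraph \<Rightarrow> 'a set" where
  "leaves G = {v \<in> verts G. out_degree G v = 1}"

definition independent_set :: "('a, 'b) pre_digraph \<Rightarrow> 'a set \<Rightarrow> bool" where
  "independent_set G S \<longleftrightarrow> S \<subseteq> verts G \<and> (\<forall>u\<in>S. \<forall>v\<in>S. \<not> u \<rightarrow>\<^bsub>G\<^esub> v)"

definition independence_number :: "('a, 'b) pre_digraph \<Rightarrow> nat" where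
  "independence_number G = Max {card S | S. independent_set G S}"

end

theory Submission
  imports Defs
begin

text \<open>
  Every nonempty set of vertices of a forest contains a vertex with at most one neighbour in that
  set. Removing such vertices one at a time yields a proper 2-colouring, and the larger colour class
  has at least half of the vertices. For the other lower bound, remove one leaf from every
  component: two adjacent leaves form a whole component, so the remaining leaves are independent.
  For the upper bound, let \<open>I\<close> be independent. The nonleaves in \<open>I\<close> have at least two neighbours
  outside \<open>I\<close>, and in a forest this forces them to be at most as many as the vertices outside \<open>I\<close>.
\<close>

lemma (in pseudo_graph) card_le_independence_number:
  assumes "independent_set G S"
  shows "card S \<le> independence_number G"
proof -
  have "finite {S. independent_set G S}"
    by (rule finite_subset[of _ "Pow (verts G)"]) (auto simp: independent_set_def)
  then show ?thesis
    using assms unfolding independence_number_def by (intro Max_ge) auto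
qed

lemma (in pseudo_graph) independence_number_attained:
  obtains S where "independent_set G S" "card S = independence_number G"
proof -
  have "finite {S. independent_set G S}"
    by (rule finite_subset[of _ "Pow (verts G)"]) (auto simp: independent_set_def)
  moreover have "independent_set G {}" by (simp add: independent_set_def)
  ultimately have "Max {card S | S. independent_set G S} \<in> {card S | S. independent_set G S}"
    by (intro Max_in) auto
  then show ?thesis using that unfolding independence_number_def by auto
qed

text \<open>Without parallel arcs, \<open>head G\<close> is injective on the arcs leaving
  \<open>v\<close>, so counting arcs is counting neighbours.\<close>

lemma (in nomulti_digraph) out_degree_eq_card_dominated:
  "out_degree G v = card {w. v \<rightarrow>\<^bsub>G\<^esub> w}"
proof -
  have "inj_on (head G) (out_arcs G v)"
    by (rule inj_onI) (auto intro!: no_multi_arcs simp: arc_to_ends_def)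
  moreover have "head G ` out_arcs G v = {w. v \<rightarrow>\<^bsub>G\<^esub> w}"
    by (auto simp: arcs_ends_conv image_iff)
  ultimately show ?thesis unfolding out_degree_def by (metis card_image)
qed

text \<open>Take a longest path inside \<open>S\<close>. All neighbours in \<open>S\<close> of its
  first vertex lie on it, and one that is not the second vertex of the path closes a cycle.\<close>

lemma (in graph) long_cycle_if_min_degree_2:
  assumes S: "S \<subseteq> verts G" "S \<noteq> {}"
    and deg: "\<And>v. v \<in> S \<Longrightarrow> 2 \<le> card {w \<in> S. v \<rightarrow>\<^bsub>G\<^esub> w}"
  shows "\<exists>p. cycle p \<and> 3 \<le> length p"
proof -
  \<comment> \<open>The start vertex is stored next to the arc list because an empty list does not
    determine it.\<close>
  define P where "P = (\<lambda>(u, p). set (awalk_verts u p) \<subseteq> S \<and> (\<exists>v. apath u p v))"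
  obtain s where "s \<in> S" using S by auto
  then have "P (s, [])" using S by (auto simp: P_def apath_Nil_iff)
  \<comment> \<open>The vertices of a path are distinct and outnumber its arcs by one. This bound
    makes a longest path exist.\<close>
  moreover have "\<forall>x. P x \<longrightarrow> length (snd x) < Suc (card (verts G))"
  proof (intro allI impI)
    fix x assume x: "P x"
    obtain u p where up: "x = (u, p)" by force
    from x up obtain v where "apath u p v" "set (awalk_verts u p) \<subseteq> S" by (auto simp: P_def)
    then have "length (awalk_verts u p) \<le> card (verts G)"
      using S by (metis apath_def card_mono distinct_card finite_verts order_trans)
    then show "length (snd x) < Suc (card (verts G))" by (simp add: up length_awalk_verts)
  qed
  ultimately have "\<exists>x. P x \<and> (\<forall>y. P y \<longrightarrow> length (snd y) \<le> length (snd x))"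
    by (rule ex_has_greatest_nat)
  then obtain x where x: "P x" and x_max: "\<forall>y. P y \<longrightarrow> length (snd y) \<le> length (snd x)"
    by (elim exE conjE)
  obtain u p where up: "x = (u, p)" by force
  from x obtain v where pS: "set (awalk_verts u p) \<subseteq> S" and p: "apath u p v"
    by (auto simp: P_def up)
  have max: "length q \<le> length p" if "P (u', q)" for u' q using x_max that up by force
  have "u \<in> S" using pS hd_in_awalk_verts(2)[OF p] by auto
  \<comment> \<open>Otherwise the arc from \<open>w\<close> to \<open>u\<close> could be put in
    front of \<open>p\<close>, giving a longer path in \<open>S\<close>.\<close>
  have nbr_on_path: "w \<in> set (awalk_verts u p)" if "w \<in> S" "u \<rightarrow>\<^bsub>G\<^esub> w" for w
  proof (rule ccontr)
    assume w: "w \<notin> set (awalk_verts u p)"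
    from that have "w \<rightarrow>\<^bsub>G\<^esub> u" using graph_symmetric by blast
    then obtain e where "e \<in> arcs G" "tail G e = w" "head G e = u" by auto
    then have "P (w, e # p)" using p w pS that by (auto simp: P_def apath_Cons_iff)
    then show False using max by fastforce
  qed
  \<comment> \<open>For nonempty \<open>p\<close>, \<open>head G (hd p)\<close> is the second vertex
    of the path. For empty \<open>p\<close> its value is unspecified, which does no harm: no single
    vertex can account for two neighbours.\<close>
  have "\<not> {w \<in> S. u \<rightarrow>\<^bsub>G\<^esub> w} \<subseteq> {head G (hd p)}"
    using deg[OF \<open>u \<in> S\<close>] card_mono[of "{head G (hd p)}" "{w \<in> S. u \<rightarrow>\<^bsub>G\<^esub> w}"] by auto
  then obtain w where w: "w \<in> S" "u \<rightarrow>\<^bsub>G\<^esub> w" "w \<noteq> head G (hd p)" by auto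
  have "cas u p v" using p by (auto simp: apath_def)
  moreover obtain xs ys where "awalk_verts u p = xs @ w # ys"
    using nbr_on_path[OF w(1,2)] by (meson split_list)
  ultimately obtain q r where q: "cas u q w" "p = q @ r" by (rule awalk_decomp_verts) blast
  have "awlast u q = w" using q(1) by (rule awlast_if_cas)
  then have apq: "apath u q w" using p q(2) by (simp add: apath_append_iff)
  have "w \<noteq> u" using w(2) adj_not_same by blast
  \<comment> \<open>The segment \<open>q\<close> from \<open>u\<close> to \<open>w\<close> is
    nonempty since \<open>w\<close> differs from \<open>u\<close>, and it is not a single arc since
    \<open>w\<close> is not the second vertex. The arc back from \<open>w\<close> to
    \<open>u\<close> therefore makes a cycle of length at least 3.\<close>
  then have "2 \<le> length q"
    using q w(3) by (cases q; cases "tl q") auto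
  moreover obtain e where e: "e \<in> arcs G" "tail G e = w" "head G e = u"
    using w(2) graph_symmetric by blast
  then have "cycle (e # q)"
    using apq unfolding cycle_def apath_def by (auto simp: awalk_Cons_iff)
  ultimately show ?thesis by (intro exI[of _ "e # q"]) simp
qed

lemma (in graph) simple_forest_low_degree_vertex:
  assumes "simple_forest G" "S \<subseteq> verts G" "S \<noteq> {}"
  obtains v where "v \<in> S" "card {w \<in> S. v \<rightarrow>\<^bsub>G\<^esub> w} \<le> 1"
proof -
  have "\<not> (\<forall>v\<in>S. 2 \<le> card {w \<in> S. v \<rightarrow>\<^bsub>G\<^esub> w})"
    using long_cycle_if_min_degree_2[of S] assms unfolding simple_forest_def by blast
  then show ?thesis using that by force
qed

lemma (in graph) simple_forest_bipartition:
  assumes "simple_forest G" "S \<subseteq> verts G"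
  shows "\<exists>A B. independent_set G A \<and> independent_set G B \<and> A \<union> B = S"
proof -
  have "finite S" using assms(2) finite_verts by (rule finite_subset)
  then show ?thesis using assms(2)
  proof (induction S rule: finite_psubset_induct)
    case (psubset S)
    show ?case
    proof (cases "S = {}")
      case True
      then show ?thesis by (simp add: independent_set_def)
    next
      case False
      then obtain v where v: "v \<in> S" "card {w \<in> S. v \<rightarrow>\<^bsub>G\<^esub> w} \<le> 1"
        using simple_forest_low_degree_vertex assms(1) psubset.prems by blast
      have one: "w = w'" if "w \<in> S" "v \<rightarrow>\<^bsub>G\<^esub> w" "w' \<in> S" "v \<rightarrow>\<^bsub>G\<^esub> w'" for w w'
        using v(2) that \<open>finite S\<close> card_le_Suc0_iff_eq[of "{w \<in> S. v \<rightarrow>\<^bsub>G\<^esub> w}"] by auto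
      have ext: "independent_set G (insert v A)"
        if "independent_set G A" "\<forall>w\<in>A. \<not> v \<rightarrow>\<^bsub>G\<^esub> w" for A
        using that v(1) psubset.prems adj_not_same graph_symmetric
        unfolding independent_set_def by blast
      obtain A B where AB: "independent_set G A" "independent_set G B" "A \<union> B = S - {v}"
        using psubset.IH[of "S - {v}"] v(1) psubset.prems by blast
      show ?thesis
      proof (cases "\<forall>w\<in>A. \<not> v \<rightarrow>\<^bsub>G\<^esub> w")
        case True
        then have "independent_set G (insert v A)" using AB(1) by (intro ext)
        moreover have "insert v A \<union> B = S" using AB(3) v(1) by auto
        ultimately show ?thesis using AB(2)
          by (intro exI[of _ "insert v A"] exI[of _ B] conjI)
      next
        case False
        \<comment> \<open>Now \<open>w\<close> is the only neighbour of \<open>v\<close> in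
          \<open>S\<close>. As \<open>A\<close> and \<open>B\<close> may overlap, \<open>w\<close>
          could also lie in \<open>B\<close>, so \<open>A\<close> is subtracted before
          \<open>v\<close> joins the other class.\<close>
        then obtain w where w: "w \<in> A" "v \<rightarrow>\<^bsub>G\<^esub> w" by auto
        have "\<not> v \<rightarrow>\<^bsub>G\<^esub> w'" if "w' \<in> B - A" for w'
          using one[of w w'] w AB(3) that by auto
        moreover have "independent_set G (B - A)"
          using AB(2) by (auto simp: independent_set_def)
        ultimately have "independent_set G (insert v (B - A))" by (intro ext) auto
        moreover have "A \<union> insert v (B - A) = S" using AB(3) v(1) by auto
        ultimately show ?thesis using AB(1)
          by (intro exI[of _ A] exI[of _ "insert v (B - A)"] conjI)
      qed
    qed
  qed
qed

lemma (in graph) card_verts_le_double_independence_number: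
  assumes "simple_forest G"
  shows "card (verts G) \<le> 2 * independence_number G"
proof -
  obtain A B where "independent_set G A" "independent_set G B" "A \<union> B = verts G"
    using simple_forest_bipartition[OF assms] by blast
  then show ?thesis
    using card_le_independence_number[of A] card_le_independence_number[of B] card_Un_le[of A B]
    by simp
qed

text \<open>Induction on \<open>B\<close> for all \<open>A\<close>: a vertex with at most one
  neighbour in the union must lie in \<open>B\<close>. Deleting it together with its neighbours in
  \<open>A\<close> costs \<open>B\<close> one vertex and \<open>A\<close> at most one.\<close>

lemma (in graph) simple_forest_card_le_if_two_neighbours:
  assumes "simple_forest G" "A \<subseteq> verts G" "B \<subseteq> verts G" "A \<inter> B = {}"
    and "\<And>a. a \<in> A \<Longrightarrow> 2 \<le> card {w \<in> B. a \<rightarrow>\<^bsub>G\<^esub> w}"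
  shows "card A \<le> card B"
proof -
  have "finite B" using assms(3) finite_verts by (rule finite_subset)
  then show ?thesis using assms(2-5)
  proof (induction B arbitrary: A rule: finite_psubset_induct)
    case (psubset B)
    have "finite A" using psubset.prems(1) finite_verts by (rule finite_subset)
    show ?case
    proof (cases "A \<union> B = {}")
      case False
      then obtain v where v: "v \<in> A \<union> B" "card {w \<in> A \<union> B. v \<rightarrow>\<^bsub>G\<^esub> w} \<le> 1"
        using simple_forest_low_degree_vertex[OF assms(1), of "A \<union> B"] psubset.prems by blast
      have "v \<notin> A"
      proof
        assume "v \<in> A"
        then have "2 \<le> card {w \<in> B. v \<rightarrow>\<^bsub>G\<^esub> w}" by (rule psubset.prems)
        also have "\<dots> \<le> card {w \<in> A \<union> B. v \<rightarrow>\<^bsub>G\<^esub> w}"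
          using \<open>finite A\<close> psubset.hyps by (intro card_mono) auto
        finally show False using v(2) by simp
      qed
      then have "v \<in> B" using v(1) by simp
      let ?N = "{w \<in> A. v \<rightarrow>\<^bsub>G\<^esub> w}"
      have "card ?N \<le> card {w \<in> A \<union> B. v \<rightarrow>\<^bsub>G\<^esub> w}"
        using \<open>finite A\<close> psubset.hyps by (intro card_mono) auto
      then have N: "card ?N \<le> 1" using v(2) by simp
      have "card (A - ?N) \<le> card (B - {v})"
      proof (rule psubset.IH)
        \<comment> \<open>By symmetry \<open>a\<close> is not adjacent to \<open>v\<close>, so it
          keeps all its neighbours in \<open>B\<close>.\<close>
        fix a assume a: "a \<in> A - ?N"
        then have "{w \<in> B - {v}. a \<rightarrow>\<^bsub>G\<^esub> w} = {w \<in> B. a \<rightarrow>\<^bsub>G\<^esub> w}"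
          using graph_symmetric by blast
        then show "2 \<le> card {w \<in> B - {v}. a \<rightarrow>\<^bsub>G\<^esub> w}" using psubset.prems(4) a by simp
      qed (use \<open>v \<in> B\<close> psubset.prems in auto)
      moreover have "card A \<le> card (A - ?N) + card ?N"
        using card_Un_le[of "A - ?N" ?N] by (simp add: Un_absorb2)
      moreover have "card B = Suc (card (B - {v}))"
        using \<open>v \<in> B\<close> psubset.hyps by (metis card_Suc_Diff1)
      ultimately show ?thesis using N by simp
    qed simp
  qed
qed

lemma (in graph) double_independence_number_le:
  assumes "simple_forest G" "\<forall>v\<in>verts G. out_degree G v \<noteq> 0"
  shows "2 * independence_number G \<le> card (verts G) + card (leaves G)"
proof -
  obtain I where I: "independent_set G I" "card I = independence_number G"
    by (rule independence_number_attained)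
  have IV: "I \<subseteq> verts G" using I(1) by (simp add: independent_set_def)
  have "card (I - leaves G) \<le> card (verts G - I)"
  proof (rule simple_forest_card_le_if_two_neighbours[OF assms(1)])
    fix a assume a: "a \<in> I - leaves G"
    \<comment> \<open>Independence puts every neighbour of \<open>a\<close> outside
      \<open>I\<close>, so the whole degree of \<open>a\<close> is counted there.\<close>
    then have "{w. a \<rightarrow>\<^bsub>G\<^esub> w} = {w \<in> verts G - I. a \<rightarrow>\<^bsub>G\<^esub> w}"
      using I(1) adj_in_verts(2) unfolding independent_set_def by blast
    moreover have "out_degree G a \<noteq> 0" "out_degree G a \<noteq> 1"
      using a IV assms(2) by (auto simp: leaves_def)
    then have "2 \<le> out_degree G a" by linarith
    ultimately show "2 \<le> card {w \<in> verts G - I. a \<rightarrow>\<^bsub>G\<^esub> w}"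
      by (metis out_degree_eq_card_dominated)
  qed (use IV in auto)
  moreover have "card I \<le> card (I - leaves G) + card (leaves G)"
    using diff_card_le_card_Diff[of "leaves G" I] by (simp add: leaves_def)
  moreover have "card (verts G) = card (verts G - I) + card I"
    using IV by (metis card_Diff_subset card_mono finite_subset finite_verts le_add_diff_inverse2)
  ultimately show ?thesis using I(2) by simp
qed

text \<open>Each of the two leaves has the other as its only neighbour, so no walk from
  \<open>u\<close> leaves the pair.\<close>

lemma (in graph) scc_of_adjacent_leaves:
  assumes "u \<in> leaves G" "v \<in> leaves G" "u \<rightarrow>\<^bsub>G\<^esub> v"
  shows "scc_of u = {u, v}"
proof -
  have only: "w = y" if "x \<in> leaves G" "x \<rightarrow>\<^bsub>G\<^esub> w" "x \<rightarrow>\<^bsub>G\<^esub> y" for x w y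
  proof -
    have "card {w. x \<rightarrow>\<^bsub>G\<^esub> w} = 1"
      using that(1) by (simp add: leaves_def out_degree_eq_card_dominated)
    then obtain z where "{w. x \<rightarrow>\<^bsub>G\<^esub> w} = {z}" by (rule card_1_singletonE)
    then show ?thesis using that(2,3) by (metis mem_Collect_eq singletonD)
  qed
  have vu: "v \<rightarrow>\<^bsub>G\<^esub> u" using assms(3) by (rule graph_symmetric)
  have "w \<in> {u, v}" if "u \<rightarrow>\<^sup>* w" for w
    using that
  proof (induction rule: reachable_induct)
    case (step x y)
    from step.IH consider "x = u" | "x = v" by auto
    then show ?case
    proof cases
      case 1
      then have "y = v" using only[of u y v] step.hyps(2) assms by simp
      then show ?thesis by simp
    next
      case 2
      then have "y = u" using only[of v y u] step.hyps(2) assms vu by simp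
      then show ?thesis by simp
    qed
  qed simp
  moreover have "u \<rightarrow>\<^sup>* u" using adj_in_verts(1)[OF assms(3)] by simp
  ultimately show ?thesis
    using assms(3) vu unfolding scc_of_def by (intro equalityI subsetI) auto
qed

lemma (in graph) card_leaves_le_independence_number:
  "card (leaves G) \<le> independence_number G + card sccs"
proof -
  \<comment> \<open>\<open>r\<close> chooses a leaf in each component that has one. Elsewhere its
    value is arbitrary, which is harmless: only the size of the image matters.\<close>
  define r where "r C = (SOME x. x \<in> C \<inter> leaves G)" for C
  have "independent_set G (leaves G - r ` sccs_verts)"
    unfolding independent_set_def
  proof (intro conjI ballI notI)
    fix u v
    assume uv: "u \<in> leaves G - r ` sccs_verts" "v \<in> leaves G - r ` sccs_verts" "u \<rightarrow>\<^bsub>G\<^esub> v"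
    \<comment> \<open>The chosen leaf of the component \<open>{u, v}\<close> is \<open>u\<close> or
      \<open>v\<close>, yet chosen leaves have been removed.\<close>
    then have scc: "scc_of u = {u, v}" by (intro scc_of_adjacent_leaves) auto
    have "u \<in> {u, v} \<inter> leaves G" using uv by simp
    then have "r {u, v} \<in> {u, v} \<inter> leaves G" unfolding r_def by (rule someI)
    then have "r {u, v} \<in> {u, v}" by blast
    moreover have "{u, v} \<in> sccs_verts"
      using scc_of_in_sccs_verts[of u] scc uv by (simp add: leaves_def)
    ultimately show False using uv by (metis DiffE imageI insertE singletonD)
  qed (auto simp: leaves_def)
  then have "card (leaves G - r ` sccs_verts) \<le> independence_number G"
    by (rule card_le_independence_number)
  moreover have "card (r ` sccs_verts) \<le> card sccs"
    using card_image_le[OF finite_sccs_verts] card_sccs_verts by metis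
  moreover have "card (leaves G) - card (r ` sccs_verts) \<le> card (leaves G - r ` sccs_verts)"
    using finite_sccs_verts by (intro diff_card_le_card_Diff) simp
  ultimately show ?thesis by simp
qed

theorem theorem10:
  fixes F :: "('a, 'b) pre_digraph" and n c :: nat
  assumes "simple_forest F"
    and "card (verts F) = n"
    and "card (pre_digraph.sccs F) = c"
    and "\<forall>v\<in>verts F. out_degree F v \<noteq> 0"
  shows "max (real n / 2) (real (card (leaves F)) - real c) \<le> real (independence_number F)
    \<and> real (independence_number F) \<le> (real n + real (card (leaves F))) / 2"
proof -
  interpret graph F using assms(1) by (simp add: simple_forest_def)
  show ?thesis
    \<comment> \<open>The three bounds over \<open>nat\<close> avoid division and subtraction, so
      they carry over to the reals directly.\<close>
    using card_verts_le_double_independence_number[OF assms(1)] card_leaves_le_independence_number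
      double_independence_number_le[OF assms(1,4)] assms(2,3)
    by (simp add: field_simps)
qed

end
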